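(* Let $m$ be a positive integer divisible by $4$, and let $\Phi_m(x)$ denote the $m$th cyclotomic polynomial. Then for every complex $z\neq0$, $$\prod_{k=1}^\infty\Phi_m\left(\tfrac zk\right)=\frac{\delta(m)}{(-\pi z)^{\varphi(m)/2}}\prod_{\substack{1\le j\le \frac m2-1\\ \gcd(j,m)=1}}\sin\left(\pi ze^{2\pi ij/m}\right),$$ where $$\delta(m)=\begin{cases} i &\text{if } m=4;\\ -1&\text{if } m=8\text{ or } m=4p^\alpha \text{ with } p \text{ a prime},\ p\equiv3\pmod 4,\ \alpha\ge1;\\ 1&\text{otherwise.}\end{cases}$$
   Context: $\varphi$ is Euler's totient function. The infinite product denotes the limit of its partial products (the value $0$ is allowed). *)

theory Defs
  imports
    "HOL-Analysis.Analysis"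
    "HOL-Computational_Algebra.Polynomial"
    "HOL-Number_Theory.Number_Theory"
begin

definition cyclotomic :: "nat \<Rightarrow> complex poly" where
  "cyclotomic m =
     (\<Prod>j\<in>totatives m. [:- exp (2 * of_real pi * \<i> * of_nat j / of_nat m), 1:])"

definition delta :: "nat \<Rightarrow> complex" where
  "delta m =
     (if m = 4 then \<i>
      else if m = 8 \<or> (\<exists>p \<alpha>. prime p \<and> [p = 3] (mod 4) \<and> \<alpha> \<ge> 1 \<and> m = 4 * p ^ \<alpha>) then -1
      else 1)"

end

theory Submission
  imports Defs
begin

text \<open>
  Since \<open>4\<close> divides \<open>m\<close>, the primitive \<open>m\<close>-th roots of unity come in pairs \<open>\<plusminus>\<omega>\<close> with
  \<open>\<omega> = exp (2\<pi>ij/m)\<close> and \<open>0 < j < m/2\<close>; this set of \<open>\<omega>\<close> is closed under \<open>\<omega> \<mapsto> -1/\<omega>\<close>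
  (that is, \<open>j \<mapsto> m/2 - j\<close>). Hence the cyclotomic polynomial is the product of the factors
  \<open>1 - (x\<omega>)\<^sup>2\<close>, and Euler's sine product turns each factor into
  \<open>sin (\<pi>z\<omega>) / (\<pi>z\<omega>)\<close>. The same symmetry gives that the product of all \<open>\<omega>\<close> is
  \<open>\<i> ^ (\<phi>(m)/2)\<close>, and it remains to find the residue of \<open>\<phi>(m)/2\<close> modulo 4.
\<close>

section \<open>Totatives in the lower half and their symmetries\<close>

definition half_totatives :: "nat \<Rightarrow> nat set" where
  "half_totatives m = {j. 1 \<le> j \<and> j \<le> m div 2 - 1 \<and> gcd j m = 1}"

definition root_unity :: "nat \<Rightarrow> nat \<Rightarrow> complex" where
  "root_unity m j = exp (2 * of_real pi * \<i> * of_nat j / of_nat m)"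

lemma finite_half_totatives [simp]: "finite (half_totatives m)"
  by (rule finite_subset[of _ "{..m}"]) (auto simp: half_totatives_def)

lemma in_half_totatives_iff:
  "j \<in> half_totatives m \<longleftrightarrow> 0 < j \<and> j < m div 2 \<and> coprime j m"
  unfolding half_totatives_def coprime_iff_gcd_eq_1 mem_Collect_eq by linarith

text \<open>For \<open>m = 4 * n\<close>, coprimality to \<open>m\<close> amounts to coprimality to
  \<open>2 * n\<close>, because the extra factor 2 already divides \<open>2 * n\<close>; and
  \<open>2 * n\<close> is exactly the shift.\<close>

lemma coprime_add_half:
  fixes j m :: nat
  assumes "4 dvd m"
  shows "coprime (j + m div 2) m \<longleftrightarrow> coprime j m"
proof -
  obtain n where m: "m = 4 * n" using assms by blast
  have "coprime x m \<longleftrightarrow> coprime x (2 * n)" for x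
    using coprime_mult_right_iff[of x 2 "2 * n"] by (auto simp: m)
  moreover have "coprime (j + 2 * n) (2 * n) \<longleftrightarrow> coprime j (2 * n)"
    unfolding coprime_iff_gcd_eq_1 by simp
  ultimately show ?thesis by (simp add: m)
qed

lemma totatives_eq_half_totatives:
  assumes "4 dvd m" "m > 0"
  shows "totatives m = half_totatives m \<union> (\<lambda>j. j + m div 2) ` half_totatives m"
proof -
  obtain n where m: "m = 4 * n" using assms by blast
  \<comment> \<open>The boundary points \<open>m div 2\<close> and \<open>m\<close> belong to
    neither half, so they must be ruled out as totatives.\<close>
  have nc: "\<not> coprime (2 * n) (4 * n)" "\<not> coprime (4 * n) (4 * n)"
    by auto
  have "j \<in> half_totatives m \<or> j \<in> (\<lambda>j. j + m div 2) ` half_totatives m"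
    if "j \<in> totatives m" for j
  proof (cases "j < 2 * n")
    case True
    then show ?thesis
      using that by (auto simp: in_half_totatives_iff in_totatives_iff m)
  next
    case False
    with that nc have "j \<noteq> 2 * n" "j \<noteq> 4 * n" "j \<le> 4 * n"
      by (auto simp: in_totatives_iff m)
    with False that coprime_add_half[OF assms(1), of "j - 2 * n"]
    have "j - 2 * n \<in> half_totatives m" "j = (j - 2 * n) + m div 2"
      by (auto simp: in_half_totatives_iff in_totatives_iff m)
    then show ?thesis by blast
  qed
  moreover have "j \<in> totatives m \<and> j + m div 2 \<in> totatives m" if "j \<in> half_totatives m" for j
    using that coprime_add_half[OF assms(1), of j]
    by (auto simp: in_half_totatives_iff in_totatives_iff m)
  ultimately show ?thesis by blast
qed

lemma half_totatives_disjoint: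
  "half_totatives m \<inter> (\<lambda>j. j + m div 2) ` half_totatives m = {}"
  by (auto simp: in_half_totatives_iff)

lemma card_half_totatives:
  assumes "4 dvd m" "m > 0"
  shows "card (half_totatives m) = totient m div 2"
proof -
  have "totient m = card (half_totatives m) + card ((\<lambda>j. j + m div 2) ` half_totatives m)"
    unfolding totient_def totatives_eq_half_totatives[OF assms]
    by (rule card_Un_disjoint) (use half_totatives_disjoint in auto)
  also have "card ((\<lambda>j. j + m div 2) ` half_totatives m) = card (half_totatives m)"
    by (rule card_image) (auto simp: inj_on_def)
  finally show ?thesis by simp
qed

text \<open>The map is an involution. It preserves coprimality to \<open>m\<close> because
  \<open>m - j\<close> is coprime to \<open>m\<close> and differs from \<open>m div 2 - j\<close> by
  the admissible shift \<open>m div 2\<close>.\<close>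

lemma bij_betw_half_totatives:
  assumes "4 dvd m"
  shows "bij_betw (\<lambda>j. m div 2 - j) (half_totatives m) (half_totatives m)"
proof (rule bij_betwI[where g = "\<lambda>j. m div 2 - j"])
  have "m div 2 - j \<in> half_totatives m" if "j \<in> half_totatives m" for j
  proof -
    from that have j: "0 < j" "j < m div 2" "coprime j m"
      by (auto simp: in_half_totatives_iff)
    have "coprime (m - j) m"
      using j by (metis coprime_commute coprime_iff_gcd_eq_1 div_le_dividend gcd_diff2_nat less_imp_le order_trans)
    moreover have "m - j = (m div 2 - j) + m div 2"
      using assms j by auto
    ultimately have "coprime (m div 2 - j) m"
      using coprime_add_half[OF assms] by metis
    then show ?thesis using j by (auto simp: in_half_totatives_iff)
  qed
  then show "(\<lambda>j. m div 2 - j) \<in> half_totatives m \<rightarrow> half_totatives m"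
    "(\<lambda>j. m div 2 - j) \<in> half_totatives m \<rightarrow> half_totatives m" by auto
qed (auto simp: in_half_totatives_iff)

section \<open>Roots of unity and their product\<close>

lemma root_unity_nonzero [simp]: "root_unity m j \<noteq> 0"
  by (simp add: root_unity_def)

lemma root_unity_add: "root_unity m (j + k) = root_unity m j * root_unity m k"
  by (simp add: root_unity_def add_divide_distrib algebra_simps flip: exp_add)

lemma root_unity_half:
  assumes "even m" "m > 0"
  shows "root_unity m (m div 2) = -1"
proof -
  have "2 * of_real pi * \<i> * of_nat (m div 2) / of_nat m = of_real pi * \<i>"
    using assms by (auto elim!: evenE)
  then show ?thesis by (simp add: root_unity_def)
qed

lemma root_unity_reflect:
  assumes "4 dvd m" "m > 0" "j \<in> half_totatives m"
  shows "root_unity m (m div 2 - j) = - inverse (root_unity m j)"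
proof -
  have "m div 2 = (m div 2 - j) + j" using assms(3) by (auto simp: in_half_totatives_iff)
  then have "root_unity m (m div 2 - j) * root_unity m j = -1"
    using root_unity_half[of m] assms root_unity_add[of m "m div 2 - j" j] by auto
  then show ?thesis by (simp add: field_simps eq_neg_iff_add_eq_0)
qed

text \<open>Reflecting \<open>j\<close> to \<open>m / 2 - j\<close> shows that the exponents sum to \<open>m / 4\<close> times their number.\<close>

lemma prod_root_unity_half_totatives:
  assumes "4 dvd m" "m > 0"
  shows "(\<Prod>j\<in>half_totatives m. root_unity m j) = \<i> ^ (totient m div 2)"
proof -
  let ?A = "half_totatives m"
  define S where "S = (\<Sum>j\<in>?A. j)"
  have "S = (\<Sum>j\<in>?A. m div 2 - j)"
    unfolding S_def using sum.reindex_bij_betw[OF bij_betw_half_totatives[OF assms(1)], of "\<lambda>j. j"] by simp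
  then have "2 * S = (\<Sum>j\<in>?A. j + (m div 2 - j))"
    by (simp add: sum.distrib S_def)
  also have "\<dots> = (\<Sum>j\<in>?A. m div 2)"
    by (intro sum.cong) (auto simp: in_half_totatives_iff)
  also have "\<dots> = card ?A * (m div 2)" by simp
  finally have "4 * S = card ?A * m" using assms(1) by auto
  then have S: "of_nat S = (of_nat (card ?A) * of_nat m / 4 :: complex)"
    by (metis (no_types, lifting) nonzero_mult_div_cancel_left of_nat_mult of_nat_numeral zero_neq_numeral)
  have "(\<Prod>j\<in>?A. root_unity m j) = exp (\<Sum>j\<in>?A. 2 * of_real pi * \<i> * of_nat j / of_nat m)"
    by (simp add: root_unity_def exp_sum)
  also have "(\<Sum>j\<in>?A. 2 * of_real pi * \<i> * of_nat j / of_nat m) = 2 * of_real pi * \<i> * of_nat S / of_nat m"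
    by (simp add: S_def sum_distrib_left sum_divide_distrib)
  also have "\<dots> = of_nat (card ?A) * (\<i> * of_real (pi / 2))"
    using assms(2) by (simp add: S)
  also have "exp \<dots> = exp (\<i> * of_real (pi / 2)) ^ card ?A"
    by (rule exp_of_nat_mult)
  also have "exp (\<i> * of_real (pi / 2)) = \<i>"
    by (simp del: of_real_divide flip: cis_conv_exp)
  finally show ?thesis by (simp add: card_half_totatives[OF assms])
qed

section \<open>Factorization of the cyclotomic polynomial\<close>

text \<open>The root of index \<open>j + m div 2\<close> is the negative of the root \<omega> of
  index \<open>j\<close>, so the linear factors pair up as (x - \<omega>)(x + \<omega>).\<close>

lemma poly_cyclotomic_half_totatives:
  assumes "4 dvd m" "m > 0"
  shows "poly (cyclotomic m) x = (\<Prod>j\<in>half_totatives m. x\<^sup>2 - (root_unity m j)\<^sup>2)"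
proof -
  let ?A = "half_totatives m"
  have "poly (cyclotomic m) x = (\<Prod>j\<in>totatives m. x - root_unity m j)"
    by (simp add: cyclotomic_def poly_prod root_unity_def)
  also have "\<dots> = (\<Prod>j\<in>?A. x - root_unity m j) * (\<Prod>j\<in>(\<lambda>j. j + m div 2) ` ?A. x - root_unity m j)"
    unfolding totatives_eq_half_totatives[OF assms]
    by (rule prod.union_disjoint) (use half_totatives_disjoint in auto)
  also have "(\<Prod>j\<in>(\<lambda>j. j + m div 2) ` ?A. x - root_unity m j) = (\<Prod>j\<in>?A. x - root_unity m (j + m div 2))"
    by (subst prod.reindex) (auto simp: inj_on_def)
  also have "(\<lambda>j. x - root_unity m (j + m div 2)) = (\<lambda>j. x + root_unity m j)"
    using assms root_unity_half[of m] by (auto simp: root_unity_add)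
  finally show ?thesis
    by (simp add: power2_eq_square algebra_simps flip: prod.distrib)
qed

text \<open>Reflecting the index replaces \<omega> by -1/\<omega>, and x^2 - \<omega>^(-2) = (1 -
  (x\<omega>)^2)(-\<omega>^(-2)). The leftover factors -\<omega>^(-2) multiply to 1, since the
  square of the product of all \<omega> is (-1) to their number.\<close>

lemma poly_cyclotomic_reflect:
  assumes "4 dvd m" "m > 0"
  shows "poly (cyclotomic m) x = (\<Prod>j\<in>half_totatives m. 1 - (x * root_unity m j)\<^sup>2)"
proof -
  let ?A = "half_totatives m"
  define P where "P = (\<Prod>j\<in>?A. root_unity m j)"
  have P2: "P\<^sup>2 = (-1) ^ card ?A"
    unfolding P_def prod_root_unity_half_totatives[OF assms] card_half_totatives[OF assms]
    by (simp add: power2_eq_square flip: power_mult_distrib)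
  have "poly (cyclotomic m) x = (\<Prod>j\<in>?A. x\<^sup>2 - (root_unity m (m div 2 - j))\<^sup>2)"
    unfolding poly_cyclotomic_half_totatives[OF assms]
    using prod.reindex_bij_betw[OF bij_betw_half_totatives[OF assms(1)], of "\<lambda>j. x\<^sup>2 - (root_unity m j)\<^sup>2"]
    by simp
  also have "\<dots> = (\<Prod>j\<in>?A. (1 - (x * root_unity m j)\<^sup>2) * (- inverse ((root_unity m j)\<^sup>2)))"
    by (intro prod.cong refl) (simp add: root_unity_reflect[OF assms] field_simps power2_eq_square)
  also have "\<dots> = (\<Prod>j\<in>?A. 1 - (x * root_unity m j)\<^sup>2) * (\<Prod>j\<in>?A. (-1) * inverse ((root_unity m j)\<^sup>2))"
    by (subst prod.distrib[symmetric]) simp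
  also have "(\<Prod>j\<in>?A. (-1) * inverse ((root_unity m j)\<^sup>2)) = (-1) ^ card ?A * inverse (P\<^sup>2)"
    unfolding prod.distrib P_def prod_constant by (simp add: prod_power_distrib prod_inversef[symmetric] o_def)
  also have "\<dots> = 1" by (simp add: P2)
  finally show ?thesis by simp
qed

section \<open>Evaluation of the sign\<close>

text \<open>The totient of an odd \<open>n > 1\<close> is even, so only its residue 0 or 2 modulo 4
  matters. It is 2 precisely when \<open>n\<close> is a power of a single prime p with p = 3 modulo
  4.\<close>

lemma i_power_totient_odd:
  assumes "odd n" "n > 1"
  shows "\<i> ^ totient n =
    (if \<exists>p \<alpha>. prime p \<and> [p = 3] (mod 4) \<and> \<alpha> \<ge> 1 \<and> n = p ^ \<alpha> then -1 else 1)"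
proof -
  obtain p where p: "prime p" "p dvd n" using assms(2) prime_factor_nat[of n] by auto
  define a where "a = multiplicity p n"
  obtain r where r: "n = p ^ a * r" "\<not> p dvd r"
    unfolding a_def by (rule multiplicity_decompose'[of n p]) (use assms(2) p(1) in auto)
  have a: "a > 0" using p assms(2) by (simp add: a_def prime_multiplicity_gt_zero_iff)
  have odd: "odd p" "odd r" using p assms(1) r by (auto elim: dvd_trans)
  have tot: "totient n = p ^ (a - 1) * (p - 1) * totient r"
    using r p a by (simp add: totient_mult_coprime totient_prime_power prime_imp_coprime)
  \<comment> \<open>The prime \<open>p\<close> was an arbitrary choice; this shows that the
    existential condition can be tested on \<open>p\<close> and \<open>r\<close> alone.\<close>
  have unique: "q = p \<and> r = 1" if "prime q" "n = q ^ b" for q b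
  proof -
    have "q = p" using p that by (metis prime_dvd_power primes_dvd_imp_eq)
    moreover have "r = 1"
    proof (rule ccontr)
      assume "r \<noteq> 1"
      then obtain s where s: "prime s" "s dvd r" using prime_factor_nat by blast
      then have "s dvd q ^ b" using r(1) that by (metis dvd_mult)
      then have "s = q" using s that by (metis prime_dvd_power primes_dvd_imp_eq)
      then show False using s r \<open>q = p\<close> by simp
    qed
    ultimately show ?thesis by simp
  qed
  show ?thesis
  proof (cases "r = 1 \<and> [p = 3] (mod 4)")
    case True
    then have "p mod 4 = 3" by (simp add: cong_def)
    then have "p = 4 * (p div 4) + 3" by presburger
    then obtain c where c: "p = 4 * c + 3" by blast
    have "totient n = 2 * (p ^ (a - 1) * (2 * c + 1))" using tot True by (simp add: c)
    moreover have "odd (p ^ (a - 1) * (2 * c + 1))" using odd by simp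
    ultimately have "\<i> ^ totient n = -1" by (simp add: power_mult)
    moreover have "\<exists>p \<alpha>. prime p \<and> [p = 3] (mod 4) \<and> \<alpha> \<ge> 1 \<and> n = p ^ \<alpha>"
      using True p(1) a r(1) by (intro exI[of _ p] exI[of _ a]) auto
    ultimately show ?thesis by simp
  next
    case False
    \<comment> \<open>Either \<open>r = 1\<close> and p = 1 modulo 4, so \<open>p - 1\<close>
      supplies the factor 4, or \<open>r > 2\<close> and both factors are even.\<close>
    have "4 dvd (p - 1) * totient r"
    proof (cases "r = 1")
      case True
      with False odd have "p mod 4 = 1" by (auto simp: cong_def) presburger
      then have "4 dvd p - 1" by presburger
      then show ?thesis by simp
    next
      case False
      with odd have "r > 2" by (cases "r = 0"; cases "r = 2") auto
      then have "2 * 2 dvd (p - 1) * totient r"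
        using odd totient_even by (intro mult_dvd_mono) auto
      then show ?thesis by simp
    qed
    then have "4 dvd totient n" unfolding tot by (simp add: mult.assoc)
    then have "\<i> ^ totient n = 1" by (auto simp: power_mult)
    then show ?thesis using unique False by auto
  qed
qed

text \<open>With \<open>m = 4 * n\<close> the exponent is \<open>totient (2 * n)\<close>, which is
  \<open>totient n\<close> for odd \<open>n\<close> and \<open>2 * totient n\<close> for even
  \<open>n\<close>. The latter is a multiple of 4 once \<open>n > 2\<close>; \<open>n = 1\<close>
  and \<open>n = 2\<close> give the special values at 4 and 8.\<close>

lemma delta_eq_i_power:
  assumes "4 dvd m" "m > 0"
  shows "delta m = \<i> ^ (totient m div 2)"
proof -
  obtain n where m: "m = 4 * n" using assms by blast
  with assms have "n > 0" by simp
  have tot: "totient m div 2 = totient (2 * n)"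
    using totient_double[of "2 * n"] by (simp add: m)
  consider "n = 1" | "n = 2" | "n > 2" "even n" | "n > 1" "odd n"
    using \<open>n > 0\<close> by (cases "n = 1"; cases "n = 2"; cases "even n") auto
  then show ?thesis
  proof cases
    case 3
    then have "even (totient n)" by (intro totient_even)
    then have "\<i> ^ (2 * totient n) = 1" by (simp add: power_mult)
    moreover have "n \<noteq> p ^ \<alpha>" if "[p = 3] (mod 4)" for p \<alpha>
    proof -
      have "odd p" using that unfolding cong_def by presburger
      then show ?thesis using 3 by auto
    qed
    ultimately show ?thesis using 3 unfolding tot by (auto simp: delta_def m totient_double)
  next
    case 4
    then have "n \<noteq> 2" by auto
    with 4 show ?thesis
      unfolding tot by (simp add: delta_def m totient_double i_power_totient_odd)
  qed (simp_all add: delta_def tot, simp_all add: m)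
qed

section \<open>Passage to the limit\<close>

lemma prod_one_minus_tendsto_sinc:
  fixes w :: complex
  assumes "w \<noteq> 0"
  shows "(\<lambda>N. \<Prod>k=1..N. 1 - (w / of_nat k)\<^sup>2) \<longlonglongrightarrow> sin (of_real pi * w) / (of_real pi * w)"
proof -
  have "(\<lambda>N. of_real pi * w * (\<Prod>k=1..N. 1 - w\<^sup>2 / of_nat k ^ 2) / (of_real pi * w))
     \<longlonglongrightarrow> sin (of_real pi * w) / (of_real pi * w)"
    by (intro tendsto_divide sin_product_formula_complex tendsto_const) (use assms in auto)
  then show ?thesis using assms by (simp add: power_divide)
qed

theorem corollary9:
  fixes m :: nat and z :: complex
  assumes "m > 0" and "4 dvd m" and "z \<noteq> 0"
  shows "(\<lambda>N. \<Prod>k=1..N. poly (cyclotomic m) (z / of_nat k))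
    \<longlonglongrightarrow> delta m / (- of_real pi * z) ^ (totient m div 2) *
      (\<Prod>j | 1 \<le> j \<and> j \<le> m div 2 - 1 \<and> gcd j m = 1.
         sin (of_real pi * z * exp (2 * of_real pi * \<i> * of_nat j / of_nat m)))"
proof -
  let ?A = "half_totatives m"
  define h where "h = totient m div 2"
  \<comment> \<open>There are finitely many \<open>j\<close>, independently of \<open>N\<close>, so
    Euler's limit may be taken in each factor separately.\<close>
  have "(\<lambda>N. \<Prod>j\<in>?A. \<Prod>k=1..N. 1 - (z * root_unity m j / of_nat k)\<^sup>2) \<longlonglongrightarrow>
      (\<Prod>j\<in>?A. sin (of_real pi * (z * root_unity m j)) / (of_real pi * (z * root_unity m j)))"
    by (intro tendsto_prod prod_one_minus_tendsto_sinc) (use assms in auto)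
  also have "(\<lambda>N. \<Prod>j\<in>?A. \<Prod>k=1..N. 1 - (z * root_unity m j / of_nat k)\<^sup>2) =
      (\<lambda>N. \<Prod>k=1..N. poly (cyclotomic m) (z / of_nat k))"
    by (subst prod.swap) (simp add: poly_cyclotomic_reflect[OF assms(2,1)])
  also have "(\<Prod>j\<in>?A. sin (of_real pi * (z * root_unity m j)) / (of_real pi * (z * root_unity m j))) =
      (\<Prod>j\<in>?A. sin (of_real pi * z * root_unity m j)) / ((of_real pi * z) ^ h * \<i> ^ h)"
    by (simp add: prod_dividef prod.distrib prod_root_unity_half_totatives[OF assms(2,1)]
          card_half_totatives[OF assms(2,1)] mult.assoc power_mult_distrib h_def)
  also have "\<dots> = \<i> ^ h / (- of_real pi * z) ^ h * (\<Prod>j\<in>?A. sin (of_real pi * z * root_unity m j))"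
  proof -
    \<comment> \<open>Moving \<open>\<i> ^ h\<close> to the numerator costs the sign
      \<open>(-1) ^ h\<close>, which accounts for the minus sign in the base of the
      denominator.\<close>
    have "\<i> ^ h * \<i> ^ h = (-1) ^ h" by (simp flip: power_mult_distrib)
    moreover have "(- of_real pi * z) ^ h = (-1) ^ h * (of_real pi * z) ^ h"
      by (simp flip: power_mult_distrib)
    ultimately show ?thesis using assms(3) by (simp add: field_simps)
  qed
  finally show ?thesis
    unfolding delta_eq_i_power[OF assms(2,1)] h_def half_totatives_def root_unity_def .
qed

end
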